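(* Let $\tau>0$, $\alpha>0$, $\sigma\in[-1,1]$, and let $\Gamma_h^0,\dots,\Gamma_h^N\subset\mathbb{R}^2$ be open discrete curves with endpoints on the $x$-axis such that for each $m=1,\dots,N$ one has $\Gamma_h^m=X_h^m(\Gamma_h^{m-1})$ with $X_h^m=\mathrm{id}+\tau v_h^m$, where $(v_h^m,\lambda_h^m,c^m)\in\mathbf{X}_h^{m-1}\times S_h^{m-1}\times\mathbb{R}$ is the solution of $$(\partial_s(\tau v_h^m+\mathrm{id}),\partial_s\eta_h)-(\lambda_h^m n_h^{m-1},\eta_h)^{(h)}-c^m(T_h^{m-1},\eta_h)^{(h)}=\sigma\,[\eta_{h,1}^{r}-\eta_{h,1}^{l}],$$ $$(v_h^m\cdot n_h^{m-1},\chi_h)^{(h)}+(\partial_s\lambda_h^m,\partial_s\chi_h)=0,$$ $$(v_h^m,T_h^{m-1})^{(h)}+\alpha c^m\|T_h^{m-1}\|_{L^2_h}=0$$ for all $(\eta_h,\chi_h)\in\mathbf{X}_h^{m-1}\times S_h^{m-1}$. Then the discrete energy $$W_h^m:=|\Gamma_h^m|-\sigma\,(x_r^m-x_l^m)$$ is non-increasing, in the sense that $W_h^m\le W_h^{m-1}$ for $m=1,2,\dots,N$. Here $|\Gamma_h^m|$ is the length of $\Gamma_h^m$, and $x_l^m$, $x_r^m$ are the $x$-coordinates of the left and right contact points (endpoints) of $\Gamma_h^m$.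
   Context: Each $\Gamma_h^{m-1}$ is an open polygonal curve in $\mathbb{R}^2$ (a chain of finitely many nondegenerate straight segments), oriented from its left endpoint to its right endpoint (the contact points), both lying on the $x$-axis $\{y=0\}$; the segments and the left/right endpoints of $\Gamma_h^m$ are the images under the piecewise linear map $X_h^m$ of those of $\Gamma_h^{m-1}$, and $|\Gamma_h^m|$ is the sum of the lengths of its segments. On $\Gamma_h^{m-1}$, $s$ is arc length and $(\cdot,\cdot)$ without superscript is the $L^2(\Gamma_h^{m-1})$ inner product. $S_h^{m-1}$ is the space of continuous real functions on $\Gamma_h^{m-1}$ that are linear (affine) on each segment; $\mathring S_h(\Gamma_h^{m-1})$ is its subspace of functions vanishing at the two endpoints, and $\mathbf{X}_h^{m-1}=S_h^{m-1}\times\mathring S_h(\Gamma_h^{m-1})$ (first and second Cartesian components). $n_h^{m-1}=(-\partial_s y,\partial_s x)^T$ is the piecewise constant unit normal. $\mathrm{id}$ is the identity map of $\Gamma_h^{m-1}$. For $\eta_h=(\eta_{h,1},\eta_{h,2})\in (S_h^{m-1})^2$, superscripts $r$ and $l$ denote its values at the right and left endpoints. The constant $\sigma$ is the cosine of the prescribed contact angle. Mass lumping: for functions $\eta,\chi$ continuous on each segment (possibly jumping at vertices), $$(\eta,\chi)^{(h)}=\frac12\sum_{l}|\sigma_l|\sum_{k=1}^2(\eta\cdot\chi)\bigl((\vec q_{l,k})^-\bigr),$$ where $\sigma_l$ runs over the segments, $|\sigma_l|$ is the length of $\sigma_l$, $\vec q_{l,1},\vec q_{l,2}$ are its endpoints,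 and $(\vec q_{l,k})^-$ denotes the limit from inside $\sigma_l$; for vector arguments the product is the Euclidean inner product. $\|f\|_{L^2_h}=\sqrt{(f,f)^{(h)}}$. Definition of $T_h^{m-1}$: let $\nu_h^{m-1}\in (S_h^{m-1})^2$ be the Riesz representative given by $$(\nu_h^{m-1},\eta_h)^{(h)}=(\partial_s \mathrm{id},\partial_s\eta_h)-\sigma\,[\eta_{h,1}^{r}-\eta_{h,1}^{l}]-\sqrt{1-\sigma^2}\,[\eta_{h,2}^{r}-\eta_{h,2}^{l}]\quad\forall\eta_h\in (S_h^{m-1})^2.$$ Then $T_h^{m-1}\in (S_h^{m-1})^2$ is determined by finding $(T_h^{m-1},\mu_h)\in (S_h^{m-1})^2\times S_h^{m-1}$ with $$(T_h^{m-1},\eta_h)^{(h)}+(\mu_h n_h^{m-1},\eta_h)^{(h)}=(\nu_h^{m-1},\eta_h)^{(h)}\quad\forall\eta_h\in (S_h^{m-1})^2,$$ $$(T_h^{m-1},n_h^{m-1}\chi_h)^{(h)}=0\quad\forall\chi_h\in S_h^{m-1}.$$ *)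

theory Defs
  imports "HOL-Analysis.Analysis"
begin

text \<open>
  A polygonal curve is the list of its vertices, listed from the left to the right endpoint;
  its segment number \<open>j\<close> joins the vertices \<open>j\<close> and \<open>Suc j\<close>.  Functions on the curve are
  functions of the arc length \<open>s\<close>, which ranges over \<open>{0..curve_length p}\<close>; their values
  elsewhere are irrelevant.
\<close>

type_synonym curve = "(real^2) list"

definition nseg :: "curve \<Rightarrow> nat" where
  "nseg p = length p - 1"

definition seg_length :: "curve \<Rightarrow> nat \<Rightarrow> real" where
  "seg_length p j = dist (p ! j) (p ! Suc j)"

text \<open>The arc length coordinate of vertex \<open>j\<close>.\<close>

definition knot :: "curve \<Rightarrow> nat \<Rightarrow> real" where
  "knot p j = (\<Sum>i<j. seg_length p i)"

definition curve_length :: "curve \<Rightarrow> real" where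
  "curve_length p = (\<Sum>j<nseg p. seg_length p j)"

definition left_end :: "curve \<Rightarrow> real^2" where
  "left_end p = p ! 0"

definition right_end :: "curve \<Rightarrow> real^2" where
  "right_end p = p ! nseg p"

text \<open>``Left'' and ``right'' only name the first and last vertex; neither an ordering of their
  \<open>x\<close>-coordinates nor embeddedness is required.\<close>

definition open_curve :: "curve \<Rightarrow> bool" where
  "open_curve p \<longleftrightarrow>
     nseg p \<ge> 1 \<and>
     (\<forall>j<nseg p. p ! j \<noteq> p ! Suc j) \<and>
     left_end p $ 2 = 0 \<and> right_end p $ 2 = 0"

text \<open>The identity map of the curve as a function of arc length, i.e. the arc length
  parametrisation.\<close>

definition curve_id :: "curve \<Rightarrow> real \<Rightarrow> real^2" where
  "curve_id p s =
     (let j = Max {j. j < nseg p \<and> knot p j \<le> s}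
      in linepath (p ! j) (p ! Suc j) ((s - knot p j) / seg_length p j))"

definition fe_space :: "curve \<Rightarrow> (real \<Rightarrow> real) set" where
  "fe_space p = {f. continuous_on {0..curve_length p} f \<and>
     (\<forall>j<nseg p. \<exists>a b. \<forall>s\<in>{knot p j..knot p (Suc j)}. f s = a + b * s)}"

definition fe_space0 :: "curve \<Rightarrow> (real \<Rightarrow> real) set" where
  "fe_space0 p = {f \<in> fe_space p. f 0 = 0 \<and> f (curve_length p) = 0}"

definition fe_space2 :: "curve \<Rightarrow> (real \<Rightarrow> real^2) set" where
  "fe_space2 p = {f. (\<lambda>s. f s $ 1) \<in> fe_space p \<and> (\<lambda>s. f s $ 2) \<in> fe_space p}"

definition fe_spaceX :: "curve \<Rightarrow> (real \<Rightarrow> real^2) set" where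
  "fe_spaceX p = {f. (\<lambda>s. f s $ 1) \<in> fe_space p \<and> (\<lambda>s. f s $ 2) \<in> fe_space0 p}"

text \<open>The derivative has no meaning at the vertices.  This affects neither the integrals nor the
  mass-lumped products below, which only see one-sided limits.\<close>

definition dds :: "(real \<Rightarrow> 'a::real_normed_vector) \<Rightarrow> real \<Rightarrow> 'a" where
  "dds f s = vector_derivative f (at s)"

definition normal :: "curve \<Rightarrow> real \<Rightarrow> real^2" where
  "normal p s = vector [- (dds (curve_id p) s $ 2), dds (curve_id p) s $ 1]"

definition l2_inner :: "curve \<Rightarrow> (real \<Rightarrow> 'a::real_inner) \<Rightarrow> (real \<Rightarrow> 'a) \<Rightarrow> real" where
  "l2_inner p f g = integral {0..curve_length p} (\<lambda>s. f s \<bullet> g s)"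

definition lumped :: "curve \<Rightarrow> (real \<Rightarrow> 'a::real_inner) \<Rightarrow> (real \<Rightarrow> 'a) \<Rightarrow> real" where
  "lumped p f g =
     1 / 2 * (\<Sum>j<nseg p. seg_length p j *
       (Lim (at_right (knot p j)) (\<lambda>s. f s \<bullet> g s) +
        Lim (at_left (knot p (Suc j))) (\<lambda>s. f s \<bullet> g s)))"

definition lumped_norm :: "curve \<Rightarrow> (real \<Rightarrow> 'a::real_inner) \<Rightarrow> real" where
  "lumped_norm p f = sqrt (lumped p f f)"

text \<open>The difference of the values at the right and left endpoints.\<close>

definition jump :: "curve \<Rightarrow> (real \<Rightarrow> real^2) \<Rightarrow> real^2" where
  "jump p f = f (curve_length p) - f 0"

text \<open>\<open>\<nu>\<close> is the Riesz representative, for the mass-lumped product, of the linear form on the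
  right-hand side; \<open>T\<close> is the first component of the solution of a saddle point system with
  data \<open>\<nu>\<close>.  Both are unique on the curve, hence given by predicates.\<close>

definition is_nu :: "real \<Rightarrow> curve \<Rightarrow> (real \<Rightarrow> real^2) \<Rightarrow> bool" where
  "is_nu \<sigma> p \<nu> \<longleftrightarrow>
     \<nu> \<in> fe_space2 p \<and>
     (\<forall>\<eta>\<in>fe_space2 p.
        lumped p \<nu> \<eta> =
          l2_inner p (dds (curve_id p)) (dds \<eta>)
          - \<sigma> * (jump p \<eta> $ 1) - sqrt (1 - \<sigma>\<^sup>2) * (jump p \<eta> $ 2))"

definition is_T :: "real \<Rightarrow> curve \<Rightarrow> (real \<Rightarrow> real^2) \<Rightarrow> bool" where
  "is_T \<sigma> p T \<longleftrightarrow>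
     T \<in> fe_space2 p \<and>
     (\<exists>\<nu> \<mu>. is_nu \<sigma> p \<nu> \<and> \<mu> \<in> fe_space p \<and>
        (\<forall>\<eta>\<in>fe_space2 p.
           lumped p T \<eta> + lumped p (\<lambda>s. \<mu> s *\<^sub>R normal p s) \<eta> = lumped p \<nu> \<eta>) \<and>
        (\<forall>\<phi>\<in>fe_space p. lumped p T (\<lambda>s. \<phi> s *\<^sub>R normal p s) = 0))"

definition scheme_solution ::
  "real \<Rightarrow> real \<Rightarrow> real \<Rightarrow> curve \<Rightarrow> (real \<Rightarrow> real^2) \<Rightarrow>
   (real \<Rightarrow> real^2) \<Rightarrow> (real \<Rightarrow> real) \<Rightarrow> real \<Rightarrow> bool" where
  "scheme_solution \<tau> \<alpha> \<sigma> p T v lam c \<longleftrightarrow>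
     v \<in> fe_spaceX p \<and> lam \<in> fe_space p \<and>
     (\<forall>\<eta>\<in>fe_spaceX p.
        l2_inner p (dds (\<lambda>s. \<tau> *\<^sub>R v s + curve_id p s)) (dds \<eta>)
        - lumped p (\<lambda>s. lam s *\<^sub>R normal p s) \<eta> - c * lumped p T \<eta>
        = \<sigma> * (jump p \<eta> $ 1)) \<and>
     (\<forall>\<phi>\<in>fe_space p.
        lumped p (\<lambda>s. v s \<bullet> normal p s) \<phi> + l2_inner p (dds lam) (dds \<phi>) = 0) \<and>
     lumped p v T + \<alpha> * c * lumped_norm p T = 0"

text \<open>For \<open>X\<close> affine on each segment, the image of a polygonal curve under \<open>X\<close> has the images of
  the vertices as its vertices.\<close>

definition image_curve :: "(real \<Rightarrow> real^2) \<Rightarrow> curve \<Rightarrow> curve" where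
  "image_curve X p = map (\<lambda>j. X (knot p j)) [0..<length p]"

definition energy :: "real \<Rightarrow> curve \<Rightarrow> real" where
  "energy \<sigma> p = curve_length p - \<sigma> * (right_end p $ 1 - left_end p $ 1)"

end

theory Submission imports Defs begin

text \<open>
  The energy decreases because the scheme may be tested with its own solution.  Take the test
  functions \<open>\<eta> = v\<close> and \<open>\<phi> = lam\<close>.  The coupling terms \<open>(lam n, v)\<close> and \<open>(v \<cdot> n, lam)\<close> have
  the same integrand, so the second equation turns the first of them into
  \<open>- (\<partial>\<^sub>s lam, \<partial>\<^sub>s lam) \<le> 0\<close>, and the third equation turns \<open>c (T, v)\<close> into
  \<open>- \<alpha> c\<^sup>2 \<parallel>T\<parallel> \<le> 0\<close>.  Writing \<open>X = id + \<tau> v\<close>, what remains is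
  \<open>(\<partial>\<^sub>s X, \<partial>\<^sub>s v) \<le> \<sigma> [v\<^sub>1]\<close>, where \<open>[v\<^sub>1]\<close> is the value at the right end minus the value
  at the left end (\<open>solution_pairing_le\<close>).

  Multiplied by \<open>\<tau>\<close>, the right-hand side is \<open>\<sigma>\<close> times the change of \<open>x\<^sub>r - x\<^sub>l\<close>.  The left-hand
  side dominates the change of length.  Indeed, on a segment of the old curve the
  derivative of \<open>id\<close> is a constant unit vector \<open>e\<close> and that of \<open>X\<close> is a constant vector \<open>u\<close>; the
  length of the segment is multiplied by \<open>\<parallel>u\<parallel>\<close>, and
  \<open>\<parallel>u\<parallel> - 1 \<le> u \<cdot> (u - e)\<close> by the Cauchy-Schwarz inequality and \<open>0 \<le> (\<parallel>u\<parallel> - 1)\<^sup>2\<close>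
  (\<open>curve_length_image_curve_le\<close>).  This is the convexity of length, and the reason why
  the implicit choice \<open>\<partial>\<^sub>s X\<close>, instead of \<open>\<partial>\<^sub>s id\<close>, in the scheme gives stability for every step
  size \<open>\<tau>\<close>.
\<close>

section \<open>Knots and the arc length parametrisation\<close>

lemma knot_0 [simp]: "knot p 0 = 0"
  by (simp add: knot_def)

lemma knot_Suc: "knot p (Suc j) = knot p j + seg_length p j"
  by (simp add: knot_def)

lemma curve_length_eq_knot: "curve_length p = knot p (nseg p)"
  by (simp add: curve_length_def knot_def)

lemma seg_length_pos:
  assumes "open_curve p" "j < nseg p"
  shows "seg_length p j > 0"
  using assms by (simp add: open_curve_def seg_length_def)

lemma knot_mono: "i \<le> j \<Longrightarrow> knot p i \<le> knot p j"
  unfolding knot_def by (rule sum_mono2) (auto simp: seg_length_def)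

lemma knot_less_Suc:
  assumes "open_curve p" "j < nseg p"
  shows "knot p j < knot p (Suc j)"
  using seg_length_pos[OF assms] by (simp add: knot_Suc)

lemma segment_subset:
  assumes "j < nseg p"
  shows "{knot p j..knot p (Suc j)} \<subseteq> {0..curve_length p}"
  using knot_mono[of 0 j p] knot_mono[of "Suc j" "nseg p" p] assms
  by (auto simp: curve_length_eq_knot)

text \<open>At an interior vertex the definition of \<^const>\<open>curve_id\<close> selects the segment that starts
  there.  Both adjacent segments give the same point, so the formula of a segment
  is valid up to and including its right endpoint.\<close>

lemma curve_id_on_segment:
  assumes p: "open_curve p" and j: "j < nseg p" and s: "s \<in> {knot p j..knot p (Suc j)}"
  shows "curve_id p s = linepath (p ! j) (p ! Suc j) ((s - knot p j) / seg_length p j)"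
proof -
  let ?J = "{i. i < nseg p \<and> knot p i \<le> s}"
  have fin: "finite ?J" by simp
  show ?thesis
  proof (cases "Suc j < nseg p \<and> s = knot p (Suc j)")
    case True
    have "i \<le> Suc j" if "i \<in> ?J" for i
    proof (rule ccontr)
      assume "\<not> i \<le> Suc j"
      then have "knot p (Suc (Suc j)) \<le> knot p i" by (intro knot_mono) simp
      with that knot_less_Suc[OF p, of "Suc j"] True show False by simp
    qed
    then have "Max ?J = Suc j" using True fin by (intro Max_eqI) auto
    then show ?thesis
      using True seg_length_pos[OF p j] by (simp add: curve_id_def knot_Suc linepath_def)
  next
    case False
    have "i \<le> j" if "i \<in> ?J" for i
    proof (rule ccontr)
      assume "\<not> i \<le> j"
      then have "knot p (Suc j) \<le> knot p i" by (intro knot_mono) simp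
      with that s have "s = knot p (Suc j)" by auto
      with that False \<open>\<not> i \<le> j\<close> show False by simp
    qed
    then have "Max ?J = j" using j s fin by (intro Max_eqI) auto
    then show ?thesis by (simp add: curve_id_def)
  qed
qed

lemma curve_id_knot:
  assumes p: "open_curve p" and j: "j \<le> nseg p"
  shows "curve_id p (knot p j) = p ! j"
proof (cases j)
  case 0
  have "nseg p > 0" using p by (simp add: open_curve_def)
  with 0 show ?thesis
    using curve_id_on_segment[OF p, of 0 0] knot_mono[of 0 1 p] by (simp add: linepath_def)
next
  case (Suc i)
  with j have i: "i < nseg p" by simp
  show ?thesis
    using curve_id_on_segment[OF p i, of "knot p j"] seg_length_pos[OF p i] Suc
    by (simp add: knot_Suc linepath_def)
qed

section \<open>Functions that are affine on each segment\<close>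

definition segmentwise_affine :: "curve \<Rightarrow> (real \<Rightarrow> 'a::real_vector) \<Rightarrow> bool" where
  "segmentwise_affine p f \<longleftrightarrow>
     (\<forall>j<nseg p. \<exists>a b. \<forall>s\<in>{knot p j..knot p (Suc j)}. f s = a + s *\<^sub>R b)"

definition slope :: "curve \<Rightarrow> (real \<Rightarrow> 'a::real_vector) \<Rightarrow> nat \<Rightarrow> 'a" where
  "slope p f j = (f (knot p (Suc j)) - f (knot p j)) /\<^sub>R seg_length p j"

lemma segmentwise_affine_curve_id:
  assumes p: "open_curve p"
  shows "segmentwise_affine p (curve_id p)"
  unfolding segmentwise_affine_def
proof (intro allI impI)
  fix j assume j: "j < nseg p"
  let ?b = "(p ! Suc j - p ! j) /\<^sub>R seg_length p j"
  have "\<forall>s\<in>{knot p j..knot p (Suc j)}. curve_id p s = (p ! j - knot p j *\<^sub>R ?b) + s *\<^sub>R ?b"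
    using curve_id_on_segment[OF p j]
    by (simp add: linepath_def algebra_simps diff_divide_distrib divide_inverse)
  then show "\<exists>a b. \<forall>s\<in>{knot p j..knot p (Suc j)}. curve_id p s = a + s *\<^sub>R b" by blast
qed

lemma segmentwise_affine_fe_space2:
  assumes "f \<in> fe_space2 p"
  shows "segmentwise_affine p f"
  unfolding segmentwise_affine_def
proof (intro allI impI)
  fix j assume "j < nseg p"
  with assms obtain a1 b1 a2 b2 where
    "\<forall>s\<in>{knot p j..knot p (Suc j)}. f s $ 1 = a1 + b1 * s"
    "\<forall>s\<in>{knot p j..knot p (Suc j)}. f s $ 2 = a2 + b2 * s"
    unfolding fe_space2_def fe_space_def by blast
  then have "\<forall>s\<in>{knot p j..knot p (Suc j)}. f s = vector [a1, a2] + s *\<^sub>R vector [b1, b2]"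
    by (simp add: vec_eq_iff forall_2 mult.commute)
  then show "\<exists>a b. \<forall>s\<in>{knot p j..knot p (Suc j)}. f s = a + s *\<^sub>R b" by blast
qed

lemma segmentwise_affine_add_scaleR:
  assumes "segmentwise_affine p f" "segmentwise_affine p g"
  shows "segmentwise_affine p (\<lambda>s. f s + r *\<^sub>R g s)"
  unfolding segmentwise_affine_def
proof (intro allI impI)
  fix j assume "j < nseg p"
  with assms obtain a b a' b' where
    "\<forall>s\<in>{knot p j..knot p (Suc j)}. f s = a + s *\<^sub>R b"
    "\<forall>s\<in>{knot p j..knot p (Suc j)}. g s = a' + s *\<^sub>R b'"
    unfolding segmentwise_affine_def by blast
  then have "\<forall>s\<in>{knot p j..knot p (Suc j)}.
      f s + r *\<^sub>R g s = (a + r *\<^sub>R a') + s *\<^sub>R (b + r *\<^sub>R b')"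
    by (simp add: algebra_simps)
  then show "\<exists>a b. \<forall>s\<in>{knot p j..knot p (Suc j)}. f s + r *\<^sub>R g s = a + s *\<^sub>R b" by blast
qed

lemma dds_eq_slope:
  fixes f :: "real \<Rightarrow> 'a::real_normed_vector"
  assumes p: "open_curve p" and j: "j < nseg p" and f: "segmentwise_affine p f"
    and s: "s \<in> {knot p j<..<knot p (Suc j)}"
  shows "dds f s = slope p f j"
proof -
  obtain a b where ab: "\<forall>s\<in>{knot p j..knot p (Suc j)}. f s = a + s *\<^sub>R b"
    using f j unfolding segmentwise_affine_def by blast
  have "((\<lambda>s. a + s *\<^sub>R b) has_vector_derivative b) (at s)"
    by (auto intro!: derivative_eq_intros)
  then have "(f has_vector_derivative b) (at s)"
    by (rule has_vector_derivative_transform_within_open[where S = "{knot p j<..<knot p (Suc j)}"])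
      (use s ab in auto)
  then have "dds f s = b" unfolding dds_def by (rule vector_derivative_at)
  also have "b = slope p f j"
    using ab knot_less_Suc[OF p j] seg_length_pos[OF p j]
    by (simp add: slope_def knot_Suc algebra_simps)
  finally show ?thesis .
qed

text \<open>Derivatives of segmentwise affine functions are controlled only between the knots, so
  nothing is assumed at the knots; they form a null set.\<close>

lemma has_integral_segmentwise_constant:
  fixes w :: "nat \<Rightarrow> real"
  assumes "\<And>j s. j < n \<Longrightarrow> s \<in> {knot p j<..<knot p (Suc j)} \<Longrightarrow> f s = w j"
  shows "(f has_integral (\<Sum>j<n. seg_length p j * w j)) {0..knot p n}"
  using assms
proof (induction n)
  case 0
  then show ?case using has_integral_refl(2)[of f "0::real"] by (simp del: has_integral_refl)
next
  case (Suc n)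
  have le: "knot p n \<le> knot p (Suc n)" by (rule knot_mono) simp
  have "((\<lambda>s. w n) has_integral (seg_length p n * w n)) {knot p n..knot p (Suc n)}"
    using has_integral_const_real[of "w n" "knot p n" "knot p (Suc n)"] le
    by (simp add: knot_Suc)
  then have "(f has_integral (seg_length p n * w n)) {knot p n..knot p (Suc n)}"
    by (rule has_integral_spike_interior[where f = "\<lambda>s. w n" and a = "knot p n"
          and b = "knot p (Suc n)", simplified]) (use Suc.prems[of n] in auto)
  moreover have "(f has_integral (\<Sum>j<n. seg_length p j * w j)) {0..knot p n}"
    by (rule Suc.IH) (use Suc.prems in simp)
  moreover have "0 \<le> knot p n" using knot_mono[of 0 n p] by simp
  ultimately show ?case
    using has_integral_combine[of 0 "knot p n" "knot p (Suc n)" f] le by simp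
qed

lemma l2_inner_dds:
  fixes f g :: "real \<Rightarrow> 'a::real_inner"
  assumes p: "open_curve p" and f: "segmentwise_affine p f" and g: "segmentwise_affine p g"
  shows "l2_inner p (dds f) (dds g) =
    (\<Sum>j<nseg p. seg_length p j * (slope p f j \<bullet> slope p g j))"
  unfolding l2_inner_def curve_length_eq_knot
proof (intro integral_unique has_integral_segmentwise_constant)
  fix j s assume "j < nseg p" "s \<in> {knot p j<..<knot p (Suc j)}"
  then show "dds f s \<bullet> dds g s = slope p f j \<bullet> slope p g j"
    using dds_eq_slope[OF p _ f] dds_eq_slope[OF p _ g] by metis
qed

lemma l2_inner_self_nonneg: "l2_inner p f f \<ge> 0"
proof (cases "(\<lambda>s. f s \<bullet> f s) integrable_on {0..curve_length p}")
  case True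
  then show ?thesis unfolding l2_inner_def by (rule integral_nonneg) simp
next
  case False
  then show ?thesis unfolding l2_inner_def by (simp add: not_integrable_integral)
qed

section \<open>Change of length under a segmentwise affine map\<close>

lemma norm_minus_one_le:
  fixes u e :: "'a::real_inner"
  assumes "norm e = 1"
  shows "norm u - 1 \<le> u \<bullet> (u - e)"
proof -
  have "u \<bullet> e \<le> norm u" using norm_cauchy_schwarz[of u e] assms by simp
  moreover have "0 \<le> (norm u - 1)\<^sup>2" by simp
  ultimately show ?thesis
    by (simp add: inner_diff_right power2_diff power2_norm_eq_inner)
qed

lemma nseg_image_curve [simp]: "nseg (image_curve X p) = nseg p"
  by (simp add: nseg_def image_curve_def)

lemma nth_image_curve:
  assumes "open_curve p" "j \<le> nseg p"
  shows "image_curve X p ! j = X (knot p j)"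
proof -
  have "j < length p" using assms by (auto simp: open_curve_def nseg_def)
  then show ?thesis by (simp add: image_curve_def)
qed

lemma curve_length_image_curve:
  assumes p: "open_curve p"
  shows "curve_length (image_curve X p) = (\<Sum>j<nseg p. seg_length p j * norm (slope p X j))"
  unfolding curve_length_def nseg_image_curve
proof (rule sum.cong[OF refl])
  fix j assume "j \<in> {..<nseg p}"
  then show "seg_length (image_curve X p) j = seg_length p j * norm (slope p X j)"
    using seg_length_pos[OF p, of j]
    by (simp add: seg_length_def[of "image_curve X p"] nth_image_curve[OF p] slope_def
        dist_norm norm_minus_commute)
qed

lemma curve_length_image_curve_le:
  fixes \<tau> :: real and v :: "real \<Rightarrow> real^2"
  assumes p: "open_curve p" and v: "segmentwise_affine p v"
  defines "X \<equiv> \<lambda>s. curve_id p s + \<tau> *\<^sub>R v s"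
  shows "curve_length (image_curve X p) - curve_length p \<le> \<tau> * l2_inner p (dds X) (dds v)"
proof -
  have X: "segmentwise_affine p X"
    unfolding X_def by (intro segmentwise_affine_add_scaleR segmentwise_affine_curve_id p v)
  have "seg_length p j * (norm (slope p X j) - 1)
      \<le> seg_length p j * (slope p X j \<bullet> (\<tau> *\<^sub>R slope p v j))" if j: "j < nseg p" for j
  proof (rule mult_left_mono)
    \<comment> \<open>The slope of the arc length parametrisation is the unit tangent.\<close>
    have "norm (slope p (curve_id p) j) = 1"
      using j seg_length_pos[OF p j]
      by (simp add: slope_def curve_id_knot[OF p] seg_length_def dist_norm norm_minus_commute)
    moreover have "slope p X j - slope p (curve_id p) j = \<tau> *\<^sub>R slope p v j"
      by (simp add: X_def slope_def algebra_simps)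
    ultimately show "norm (slope p X j) - 1 \<le> slope p X j \<bullet> (\<tau> *\<^sub>R slope p v j)"
      using norm_minus_one_le[of "slope p (curve_id p) j" "slope p X j"] by simp
    show "0 \<le> seg_length p j" using seg_length_pos[OF p j] by simp
  qed
  then have "(\<Sum>j<nseg p. seg_length p j * (norm (slope p X j) - 1))
      \<le> (\<Sum>j<nseg p. seg_length p j * (slope p X j \<bullet> (\<tau> *\<^sub>R slope p v j)))"
    by (intro sum_mono) simp
  then show ?thesis
    by (simp add: curve_length_image_curve[OF p] l2_inner_dds[OF p X v] curve_length_def[of p]
        right_diff_distrib sum_subtractf sum_distrib_left mult.left_commute)
qed

lemma energy_image_curve:
  fixes \<tau> :: real and v :: "real \<Rightarrow> real^2"
  assumes p: "open_curve p"
  defines "X \<equiv> \<lambda>s. curve_id p s + \<tau> *\<^sub>R v s"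
  shows "energy \<sigma> (image_curve X p) - energy \<sigma> p =
    curve_length (image_curve X p) - curve_length p - \<tau> * (\<sigma> * (jump p v $ 1))"
proof -
  have "right_end (image_curve X p) = right_end p + \<tau> *\<^sub>R v (curve_length p)"
    by (simp add: right_end_def nth_image_curve[OF p] X_def curve_id_knot[OF p]
        curve_length_eq_knot)
  moreover have "left_end (image_curve X p) = left_end p + \<tau> *\<^sub>R v 0"
    using curve_id_knot[OF p, of 0]
    by (simp add: left_end_def nth_image_curve[OF p] X_def)
  ultimately show ?thesis by (simp add: energy_def jump_def algebra_simps)
qed

section \<open>Testing the scheme with its solution\<close>

text \<open>The square root of a negative number is negative here, so the dissipative sign of the
  term \<open>\<alpha> c\<^sup>2 \<parallel>T\<parallel>\<close> rests on this lemma.  Continuity makes the one-sided limits in the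
  lumped product values of the integrand.\<close>

lemma lumped_self_nonneg:
  assumes p: "open_curve p" and f: "continuous_on {0..curve_length p} (\<lambda>s. f s \<bullet> f s)"
  shows "lumped p f f \<ge> 0"
proof -
  have "0 \<le> seg_length p j * (Lim (at_right (knot p j)) (\<lambda>s. f s \<bullet> f s) +
        Lim (at_left (knot p (Suc j))) (\<lambda>s. f s \<bullet> f s))" if j: "j < nseg p" for j
  proof -
    have c: "continuous_on {knot p j..knot p (Suc j)} (\<lambda>s. f s \<bullet> f s)"
      using f segment_subset[OF j] by (rule continuous_on_subset)
    have "Lim (at_right (knot p j)) (\<lambda>s. f s \<bullet> f s) = f (knot p j) \<bullet> f (knot p j)"
      using continuous_on_Icc_at_rightD[OF c knot_less_Suc[OF p j]]
      by (intro tendsto_Lim) auto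
    moreover have "Lim (at_left (knot p (Suc j))) (\<lambda>s. f s \<bullet> f s)
        = f (knot p (Suc j)) \<bullet> f (knot p (Suc j))"
      using continuous_on_Icc_at_leftD[OF c knot_less_Suc[OF p j]]
      by (intro tendsto_Lim) auto
    ultimately show ?thesis using seg_length_pos[OF p j] by simp
  qed
  then show ?thesis unfolding lumped_def
    by (intro mult_nonneg_nonneg[of "1 / 2"] sum_nonneg) auto
qed

lemma lumped_norm_nonneg:
  assumes p: "open_curve p" and f: "f \<in> fe_space2 p"
  shows "lumped_norm p f \<ge> 0"
proof -
  have "continuous_on {0..curve_length p} (\<lambda>s. f s $ 1 * f s $ 1 + f s $ 2 * f s $ 2)"
    using f by (intro continuous_on_add continuous_on_mult)
      (simp_all add: fe_space2_def fe_space_def)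
  then show ?thesis
    unfolding lumped_norm_def using lumped_self_nonneg[OF p, of f]
    by (simp add: inner_vec_def sum_2)
qed

lemma fe_spaceX_subset: "fe_spaceX p \<subseteq> fe_space2 p"
  by (auto simp: fe_spaceX_def fe_space0_def fe_space2_def)

lemma lumped_commute: "lumped p f g = lumped p g f"
  by (simp add: lumped_def inner_commute)

lemma lumped_scaleR_left: "lumped p (\<lambda>s. l s *\<^sub>R f s) g = lumped p (\<lambda>s. g s \<bullet> f s) l"
  by (simp add: lumped_def inner_commute mult.commute)

text \<open>The test functions \<open>v\<close> and \<open>lam\<close> make the coupling terms of the first two equations
  cancel and leave only dissipation.\<close>

lemma solution_pairing_le:
  assumes p: "open_curve p" and T: "T \<in> fe_space2 p" and "\<alpha> > 0"
    and sol: "scheme_solution \<tau> \<alpha> \<sigma> p T v lam c"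
  shows "l2_inner p (dds (\<lambda>s. curve_id p s + \<tau> *\<^sub>R v s)) (dds v) \<le> \<sigma> * (jump p v $ 1)"
proof -
  have 1: "l2_inner p (dds (\<lambda>s. curve_id p s + \<tau> *\<^sub>R v s)) (dds v)
      - lumped p (\<lambda>s. lam s *\<^sub>R normal p s) v - c * lumped p T v = \<sigma> * (jump p v $ 1)"
    using sol by (simp add: scheme_solution_def add.commute)
  have "lumped p (\<lambda>s. v s \<bullet> normal p s) lam + l2_inner p (dds lam) (dds lam) = 0"
    using sol by (simp add: scheme_solution_def)
  then have 2: "lumped p (\<lambda>s. lam s *\<^sub>R normal p s) v \<le> 0"
    using l2_inner_self_nonneg[of p "dds lam"] by (simp add: lumped_scaleR_left)
  have "lumped p v T + \<alpha> * c * lumped_norm p T = 0"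
    using sol by (simp add: scheme_solution_def)
  then have "c * lumped p T v = - (\<alpha> * c\<^sup>2 * lumped_norm p T)"
    by (simp add: lumped_commute[of p T v] power2_eq_square eq_neg_iff_add_eq_0[symmetric])
  also have "\<dots> \<le> 0" using \<open>\<alpha> > 0\<close> lumped_norm_nonneg[OF p T] by simp
  finally have 3: "c * lumped p T v \<le> 0" .
  from 1 2 3 show ?thesis by linarith
qed

section \<open>Energy decay\<close>

lemma energy_step_le:
  assumes p: "open_curve p" and T: "T \<in> fe_space2 p" and "\<tau> > 0" "\<alpha> > 0"
    and sol: "scheme_solution \<tau> \<alpha> \<sigma> p T v lam c"
  shows "energy \<sigma> (image_curve (\<lambda>s. curve_id p s + \<tau> *\<^sub>R v s) p) \<le> energy \<sigma> p"
proof -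
  have "v \<in> fe_space2 p"
    using sol fe_spaceX_subset by (auto simp: scheme_solution_def)
  then have "curve_length (image_curve (\<lambda>s. curve_id p s + \<tau> *\<^sub>R v s) p) - curve_length p
      \<le> \<tau> * l2_inner p (dds (\<lambda>s. curve_id p s + \<tau> *\<^sub>R v s)) (dds v)"
    by (intro curve_length_image_curve_le p segmentwise_affine_fe_space2)
  also have "\<dots> \<le> \<tau> * (\<sigma> * (jump p v $ 1))"
    using solution_pairing_le[OF p T \<open>\<alpha> > 0\<close> sol] \<open>\<tau> > 0\<close> by (intro mult_left_mono) auto
  finally show ?thesis
    using energy_image_curve[OF p, of \<sigma> \<tau> v] by linarith
qed

theorem theorem3p2:
  fixes \<tau> \<alpha> \<sigma> :: real and N :: nat
    and \<Gamma> :: "nat \<Rightarrow> curve"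
    and T v :: "nat \<Rightarrow> real \<Rightarrow> real^2"
    and lam :: "nat \<Rightarrow> real \<Rightarrow> real"
    and c :: "nat \<Rightarrow> real"
  assumes "\<tau> > 0" and "\<alpha> > 0" and "\<sigma> \<in> {-1..1}"
    and "\<forall>m\<le>N. open_curve (\<Gamma> m)"
    and "\<forall>m\<in>{1..N}. is_T \<sigma> (\<Gamma> (m - 1)) (T (m - 1))"
    and "\<forall>m\<in>{1..N}. scheme_solution \<tau> \<alpha> \<sigma> (\<Gamma> (m - 1)) (T (m - 1)) (v m) (lam m) (c m)"
    and "\<forall>m\<in>{1..N}. \<Gamma> m = image_curve (\<lambda>s. curve_id (\<Gamma> (m - 1)) s + \<tau> *\<^sub>R v m s) (\<Gamma> (m - 1))"
  shows "\<forall>m\<in>{1..N}. energy \<sigma> (\<Gamma> m) \<le> energy \<sigma> (\<Gamma> (m - 1))"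
proof
  fix m assume m: "m \<in> {1..N}"
  let ?p = "\<Gamma> (m - 1)"
  have "open_curve ?p" using assms(4) m by auto
  moreover have "T (m - 1) \<in> fe_space2 ?p" using assms(5) m by (auto simp: is_T_def)
  moreover have "scheme_solution \<tau> \<alpha> \<sigma> ?p (T (m - 1)) (v m) (lam m) (c m)"
    using assms(6) m by blast
  ultimately have "energy \<sigma> (image_curve (\<lambda>s. curve_id ?p s + \<tau> *\<^sub>R v m s) ?p) \<le> energy \<sigma> ?p"
    using \<open>\<tau> > 0\<close> \<open>\<alpha> > 0\<close> by (intro energy_step_le)
  then show "energy \<sigma> (\<Gamma> m) \<le> energy \<sigma> ?p" using assms(7) m by metis
qed

end
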